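(* Let $(W,S)$ be a Coxeter system with $S$ finite, and let $\mathcal{L}(W,S)$ be its language of reduced words. For each regular partition $\mathscr{R}$ of $W$ there exists an explicitly defined reduced automaton recognising $\mathcal{L}(W,S)$, with accept states being the parts of $\mathscr{R}$, namely the automaton $\mathcal{A}(\mathscr{R})=(\mathscr{R},\mu,\{e\})$ with start state the part $\{e\}$ and transition function $$\mu(R,s)=\begin{cases}R'&\text{if } s\notin D_L(R)\text{ and } sR\subseteq R'\in\mathscr{R},\\ \dagger&\text{if } s\in D_L(R).\end{cases}$$ Moreover, every reduced automaton recognising $\mathcal{L}(W,S)$ arises in such a way from some regular partition $\mathscr{R}$ of $W$; that is, it is isomorphic to $\mathcal{A}(\mathscr{R})$ for some regular partition $\mathscr{R}$.
   Context: $\ell$ is the length function of $(W,S)$, $e$ the identity, and $D_L(w)=\{s\in S\mid \ell(sw)=\ell(w)-1\}$ the left descent set of $w\in W$. A partition of $W$ is a set of pairwise disjoint subsets of $W$ (the parts) with union $W$. A partition $\mathscr{R}$ is regular if: (1) for each part $R$, $D_L(x)=D_L(y)$ for all $x,y\in R$ (this common value is written $D_L(R)$); and (2) if $R\in\mathscr{R}$ and $s\in S\setminus D_L(R)$ then $sR\subseteq R'$ for some part $R'\in\mathscr{R}$. (By (1) the part containing $e$ is $\{e\}$.) A word $(s_1,\ldots,s_n)\in S^n$ is reduced if $\ell(s_1\cdots s_n)=n$; $\mathcal{L}(W,S)$ is the set of all reduced words. An automaton with alphabet $S$ is $\mathcal{A}=(Y,\mu,o)$, where $Y$ is a set of states (not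 necessarily finite; these are the accept states), $o\in Y$ is the start state, $\dagger\notin Y$ is a dead state, and $\mu:(Y\cup\{\dagger\})\times S\to Y\cup\{\dagger\}$ satisfies $\mu(\dagger,s)=\dagger$ for all $s\in S$. A word $(s_1,\ldots,s_n)$ is accepted if $y_n\in Y$, where $y_0=o$ and $y_j=\mu(y_{j-1},s_j)$ for $1\leq j\leq n$. The automaton recognises $\mathcal{L}(W,S)$ if the set of accepted words is exactly $\mathcal{L}(W,S)$. An automaton recognising $\mathcal{L}(W,S)$ is reduced if whenever $w=s_1\cdots s_n$ and $w=s_1'\cdots s_n'$ are both reduced expressions for the same element $w\in W$, the paths starting at $o$ with edge labels $(s_1,\ldots,s_n)$ and $(s_1',\ldots,s_n')$ finish at the same state. Automata $(Y,\mu,o)$ and $(Y',\mu',o')$ recognising $\mathcal{L}(W,S)$, with dead states $\dagger$ and $\dagger'$, are isomorphic if there is a function $f:Y\cup\{\dagger\}\to Y'\cup\{\dagger'\}$, injective on $Y$, such that: $f(o)=o'$, $f(\dagger)=\dagger'$ and $f(Y)=Y'$; if $x,y\in Y$ with $\mu(x,s)=y$ then $\mu'(f(x),s)=f(y)$; and if $x',y'\in Y'$ with $\mu'(x',s)=y'$ then there exist $x,y\in Y$ with $f(x)=x'$, $f(y)=y'$ and $\mu(x,s)=y$.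
   Formalization: In the "moreover" part the automaton is also assumed to have every accept state reachable from the start state; without this the claim fails (W trivial, S empty, two accept states), and no automaton with an unreachable accept state is isomorphic to any A(R). *)

theory Defs
  imports "HOL-Algebra.Algebra" "HOL-Library.Disjoint_Sets"
begin

section \<open>Coxeter systems\<close>

text \<open>A group word over \<open>S\<close> is a list of signed letters: \<open>(s, True)\<close> stands for the generator \<open>s\<close>
  and \<open>(s, False)\<close> for its formal inverse.\<close>

definition gword_value :: "('a, 'b) monoid_scheme \<Rightarrow> ('a \<times> bool) list \<Rightarrow> 'a" where
  "gword_value W us =
     foldr (\<lambda>(s, b) x. (if b then s else inv\<^bsub>W\<^esub> s) \<otimes>\<^bsub>W\<^esub> x) us \<one>\<^bsub>W\<^esub>"

text \<open>Equality of group words in the abstract group with generators \<open>S\<close> and relators \<open>Rel\<close>,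
  that is, in the free group on \<open>S\<close> modulo the normal closure of \<open>Rel\<close>.\<close>

inductive presented_eq :: "'a set \<Rightarrow> ('a \<times> bool) list set \<Rightarrow>
    ('a \<times> bool) list \<Rightarrow> ('a \<times> bool) list \<Rightarrow> bool" for S Rel where
  refl: "presented_eq S Rel us us"
| sym: "presented_eq S Rel us vs \<Longrightarrow> presented_eq S Rel vs us"
| trans: "presented_eq S Rel us vs \<Longrightarrow> presented_eq S Rel vs ws \<Longrightarrow> presented_eq S Rel us ws"
| cancel: "s \<in> S \<Longrightarrow> presented_eq S Rel (us @ [(s, b), (s, \<not> b)] @ vs) (us @ vs)"
| relator: "r \<in> Rel \<Longrightarrow> presented_eq S Rel (us @ r @ vs) (us @ vs)"

definition has_presentation ::
    "('a, 'b) monoid_scheme \<Rightarrow> 'a set \<Rightarrow> ('a \<times> bool) list set \<Rightarrow> bool" where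
  "has_presentation W S Rel \<longleftrightarrow>
     group W \<and> S \<subseteq> carrier W \<and> generate W S = carrier W \<and>
     (\<forall>us \<in> lists (S \<times> UNIV). gword_value W us = \<one>\<^bsub>W\<^esub> \<longleftrightarrow> presented_eq S Rel us [])"

text \<open>The entry \<open>0\<close> of a Coxeter matrix encodes \<open>\<infinity>\<close>; the corresponding relator below is then
  the empty word, so it imposes nothing.\<close>

definition coxeter_matrix :: "'a set \<Rightarrow> ('a \<Rightarrow> 'a \<Rightarrow> nat) \<Rightarrow> bool" where
  "coxeter_matrix S m \<longleftrightarrow>
     (\<forall>s\<in>S. m s s = 1) \<and>
     (\<forall>s\<in>S. \<forall>t\<in>S. s \<noteq> t \<longrightarrow> m s t = m t s \<and> (m s t = 0 \<or> 2 \<le> m s t))"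

definition coxeter_relators :: "'a set \<Rightarrow> ('a \<Rightarrow> 'a \<Rightarrow> nat) \<Rightarrow> ('a \<times> bool) list set" where
  "coxeter_relators S m =
     {concat (replicate (m s t) [(s, True), (t, True)]) | s t. s \<in> S \<and> t \<in> S}"

definition coxeter_system :: "('a, 'b) monoid_scheme \<Rightarrow> 'a set \<Rightarrow> bool" where
  "coxeter_system W S \<longleftrightarrow>
     (\<exists>m. coxeter_matrix S m \<and> has_presentation W S (coxeter_relators S m))"

section \<open>Length, descents and reduced words\<close>

definition word_prod :: "('a, 'b) monoid_scheme \<Rightarrow> 'a list \<Rightarrow> 'a" where
  "word_prod W ss = foldr (\<lambda>s x. s \<otimes>\<^bsub>W\<^esub> x) ss \<one>\<^bsub>W\<^esub>"

definition cox_length :: "('a, 'b) monoid_scheme \<Rightarrow> 'a set \<Rightarrow> 'a \<Rightarrow> nat" where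
  "cox_length W S w = (LEAST n. \<exists>ss \<in> lists S. length ss = n \<and> word_prod W ss = w)"

definition left_descents :: "('a, 'b) monoid_scheme \<Rightarrow> 'a set \<Rightarrow> 'a \<Rightarrow> 'a set" where
  "left_descents W S w = {s \<in> S. cox_length W S (s \<otimes>\<^bsub>W\<^esub> w) + 1 = cox_length W S w}"

definition reduced_words :: "('a, 'b) monoid_scheme \<Rightarrow> 'a set \<Rightarrow> 'a list set" where
  "reduced_words W S = {ss \<in> lists S. cox_length W S (word_prod W ss) = length ss}"

section \<open>Regular partitions\<close>

text \<open>The common value of the left descent set on the part \<open>R\<close>; meaningful only if \<open>R\<close> is
  nonempty and the left descent set is constant on \<open>R\<close>.\<close>

definition part_descents :: "('a, 'b) monoid_scheme \<Rightarrow> 'a set \<Rightarrow> 'a set \<Rightarrow> 'a set" where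
  "part_descents W S R = (THE D. \<forall>x\<in>R. left_descents W S x = D)"

definition regular_partition :: "('a, 'b) monoid_scheme \<Rightarrow> 'a set \<Rightarrow> 'a set set \<Rightarrow> bool" where
  "regular_partition W S P \<longleftrightarrow>
     partition_on (carrier W) P \<and>
     (\<forall>R\<in>P. \<forall>x\<in>R. \<forall>y\<in>R. left_descents W S x = left_descents W S y) \<and>
     (\<forall>R\<in>P. \<forall>s \<in> S - part_descents W S R. \<exists>R'\<in>P. s <#\<^bsub>W\<^esub> R \<subseteq> R')"

section \<open>Automata\<close>

text \<open>The accept states have type \<open>'q\<close> and the dead state is \<open>None :: 'q option\<close>, so
  \<open>Y \<union> {\<dagger>}\<close> is \<open>insert None (Some ` Y)\<close>. Only the transitions out of accept states are recorded;
  \<open>au_step\<close> extends them by \<open>\<mu>(\<dagger>, s) = \<dagger>\<close>.\<close>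

record ('q, 's) automaton =
  au_states :: "'q set"
  au_trans :: "'q \<Rightarrow> 's \<Rightarrow> 'q option"
  au_start :: 'q

definition is_automaton :: "'s set \<Rightarrow> ('q, 's) automaton \<Rightarrow> bool" where
  "is_automaton S A \<longleftrightarrow>
     au_start A \<in> au_states A \<and>
     (\<forall>y \<in> au_states A. \<forall>s\<in>S. au_trans A y s \<in> insert None (Some ` au_states A))"

definition au_step :: "('q, 's) automaton \<Rightarrow> 'q option \<Rightarrow> 's \<Rightarrow> 'q option" where
  "au_step A z s = (case z of None \<Rightarrow> None | Some y \<Rightarrow> au_trans A y s)"

definition au_run :: "('q, 's) automaton \<Rightarrow> 's list \<Rightarrow> 'q option" where
  "au_run A ss = foldl (au_step A) (Some (au_start A)) ss"

definition au_accepted :: "'s set \<Rightarrow> ('q, 's) automaton \<Rightarrow> 's list set" where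
  "au_accepted S A = {ss \<in> lists S. au_run A ss \<in> Some ` au_states A}"

text \<open>The automata considered have no unreachable accept states. Isomorphisms preserve reachability
  and every part of a regular partition is reachable in its automaton, so an automaton with an
  unreachable accept state cannot come from a regular partition.\<close>

definition au_accessible :: "'s set \<Rightarrow> ('q, 's) automaton \<Rightarrow> bool" where
  "au_accessible S A \<longleftrightarrow> (\<forall>y \<in> au_states A. \<exists>ss \<in> lists S. au_run A ss = Some y)"

definition recognises_reduced_words ::
    "('a, 'b) monoid_scheme \<Rightarrow> 'a set \<Rightarrow> ('q, 'a) automaton \<Rightarrow> bool" where
  "recognises_reduced_words W S A \<longleftrightarrow> is_automaton S A \<and> au_accepted S A = reduced_words W S"

definition reduced_automaton ::
    "('a, 'b) monoid_scheme \<Rightarrow> 'a set \<Rightarrow> ('q, 'a) automaton \<Rightarrow> bool" where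
  "reduced_automaton W S A \<longleftrightarrow>
     recognises_reduced_words W S A \<and>
     (\<forall>ss \<in> reduced_words W S. \<forall>ss' \<in> reduced_words W S.
        word_prod W ss = word_prod W ss' \<longrightarrow> au_run A ss = au_run A ss')"

text \<open>An isomorphism maps dead state to dead state and accept states onto accept states, so it is
  given by its restriction \<open>f\<close> to the accept states.\<close>

definition automata_isomorphic ::
    "'s set \<Rightarrow> ('q, 's) automaton \<Rightarrow> ('r, 's) automaton \<Rightarrow> bool" where
  "automata_isomorphic S A B \<longleftrightarrow>
     (\<exists>f. inj_on f (au_states A) \<and>
          f (au_start A) = au_start B \<and>
          f ` au_states A = au_states B \<and>
          (\<forall>x \<in> au_states A. \<forall>y \<in> au_states A. \<forall>s\<in>S.
             au_trans A x s = Some y \<longrightarrow> au_trans B (f x) s = Some (f y)) \<and>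
          (\<forall>x' \<in> au_states B. \<forall>y' \<in> au_states B. \<forall>s\<in>S.
             au_trans B x' s = Some y' \<longrightarrow>
             (\<exists>x \<in> au_states A. \<exists>y \<in> au_states A.
                f x = x' \<and> f y = y' \<and> au_trans A x s = Some y)))"

definition partition_automaton ::
    "('a, 'b) monoid_scheme \<Rightarrow> 'a set \<Rightarrow> 'a set set \<Rightarrow> ('a set, 'a) automaton" where
  "partition_automaton W S P =
     \<lparr> au_states = P,
       au_trans = (\<lambda>R s. if s \<in> part_descents W S R then None
                         else Some (THE R'. R' \<in> P \<and> s <#\<^bsub>W\<^esub> R \<subseteq> R')),
       au_start = {\<one>\<^bsub>W\<^esub>} \<rparr>"

end

theory Submission
  imports Defs
begin

text \<open>The relators of a Coxeter system have even length, so \<open>\<ell>(sw) = \<ell>(w) \<plusminus> 1\<close>; hence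
  appending \<open>s\<close> to a reduced word of \<open>w\<close> gives a reduced word iff \<open>s \<notin> D\<^sub>L(w\<inverse>)\<close>.
  By induction, \<open>\<A>(\<R>)\<close> reads a reduced word of \<open>w\<close> to the part containing \<open>w\<inverse>\<close>, and every
  other word to the dead state. Conversely, for a reduced automaton the state reached by the
  reduced words of \<open>w\<inverse>\<close> is a function of \<open>w\<close>, and its fibres form the desired regular partition.\<close>

section \<open>Parity of word length under the relators\<close>

text \<open>A cancellation removes two letters and a relator an even number of them, so the parity
  of the length is an invariant of the presented element.\<close>

lemma presented_eq_parity:
  assumes "presented_eq S Rel us vs" and "\<forall>r\<in>Rel. even (length r)"
  shows "even (length us) = even (length vs)"
  using assms by induction auto

text \<open>The relator of \<open>s\<close> and \<open>t\<close> has length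
  \<open>2 * m s t\<close>; the entry \<open>0\<close> gives the empty word and fits the same
  count.\<close>

lemma even_length_coxeter_relator: "r \<in> coxeter_relators S m \<Longrightarrow> even (length r)"
  by (auto simp: coxeter_relators_def length_concat sum_list_replicate)

lemma word_prod_conv_gword_value: "word_prod W ss = gword_value W (map (\<lambda>s. (s, True)) ss)"
  by (induction ss) (auto simp: word_prod_def gword_value_def)

lemma word_prod_Nil [simp]: "word_prod W [] = \<one>\<^bsub>W\<^esub>"
  by (simp add: word_prod_def)

lemma word_prod_Cons [simp]: "word_prod W (s # ss) = s \<otimes>\<^bsub>W\<^esub> word_prod W ss"
  by (simp add: word_prod_def)

lemma au_run_snoc: "au_run A (ss @ [s]) = au_step A (au_run A ss) s"
  by (simp add: au_run_def)

lemma au_step_simps [simp]: "au_step A None s = None" "au_step A (Some y) s = au_trans A y s"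
  by (simp_all add: au_step_def)

section \<open>Length and left descents in a Coxeter group\<close>

locale coxeter_group = group W for W :: "('a, 'b) monoid_scheme" (structure) +
  fixes S :: "'a set"
  assumes coxeter: "coxeter_system W S"
begin

abbreviation len :: "'a \<Rightarrow> nat" where "len \<equiv> cox_length W S"

lemma generators_closed: "S \<subseteq> carrier W"
  using coxeter by (auto simp: coxeter_system_def has_presentation_def)

lemma generator_closed [simp, intro]: "s \<in> S \<Longrightarrow> s \<in> carrier W"
  using generators_closed by auto

lemma generate_eq_carrier: "generate W S = carrier W"
  using coxeter by (auto simp: coxeter_system_def has_presentation_def)

text \<open>The diagonal entry \<open>m s s = 1\<close> contributes the relator
  \<open>ss\<close>.\<close>

lemma generator_square: assumes "s \<in> S" shows "s \<otimes> s = \<one>"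
proof -
  obtain m where m: "coxeter_matrix S m" and pres: "has_presentation W S (coxeter_relators S m)"
    using coxeter by (auto simp: coxeter_system_def)
  have "m s s = 1" using m assms by (auto simp: coxeter_matrix_def)
  then have "[(s, True), (s, True)] \<in> coxeter_relators S m"
    using assms by (force simp: coxeter_relators_def)
  then have "presented_eq S (coxeter_relators S m) ([] @ [(s, True), (s, True)] @ []) ([] @ [])"
    by (rule presented_eq.relator)
  then have "gword_value W [(s, True), (s, True)] = \<one>"
    using pres assms unfolding has_presentation_def by auto
  then show ?thesis using assms by (simp add: gword_value_def)
qed

lemma inv_generator: "s \<in> S \<Longrightarrow> inv s = s"
  using generator_square generator_closed inv_equality by blast

lemma generator_mult_cancel: "s \<in> S \<Longrightarrow> w \<in> carrier W \<Longrightarrow> s \<otimes> (s \<otimes> w) = w"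
  by (simp add: generator_square flip: m_assoc)

lemma word_prod_closed [simp]: "ss \<in> lists S \<Longrightarrow> word_prod W ss \<in> carrier W"
  by (induction ss) auto

lemma word_prod_append:
  "ss \<in> lists S \<Longrightarrow> ts \<in> lists S \<Longrightarrow>
    word_prod W (ss @ ts) = word_prod W ss \<otimes> word_prod W ts"
  by (induction ss) (auto simp: m_assoc)

lemma word_prod_rev: "ss \<in> lists S \<Longrightarrow> word_prod W (rev ss) = inv (word_prod W ss)"
  by (induction ss)
    (auto simp: word_prod_append inv_mult_group inv_generator in_lists_conv_set)

text \<open>Generators are involutions, so words without inverse letters already exhaust the
  generated group. Hence the minimum in \<open>cox_length\<close> is taken over a nonempty
  set.\<close>

lemma word_prod_surj: assumes "w \<in> carrier W" shows "\<exists>ss\<in>lists S. word_prod W ss = w"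
proof -
  have "w \<in> generate W S" using assms generate_eq_carrier by simp
  then show ?thesis
  proof induction
    case one
    show ?case by (rule bexI[of _ "[]"]) auto
  next
    case (incl h)
    then show ?case by (intro bexI[of _ "[h]"]) auto
  next
    case (inv h)
    then show ?case by (intro bexI[of _ "[h]"]) (auto simp: inv_generator)
  next
    case (eng h1 h2)
    then obtain ss ts where "ss \<in> lists S" "ts \<in> lists S" "word_prod W ss = h1" "word_prod W ts = h2"
      by blast
    then show ?case by (intro bexI[of _ "ss @ ts"]) (auto simp: word_prod_append)
  qed
qed

text \<open>This rests on the completeness of the presentation: a word with trivial product can be
  rewritten to the empty word by even relators and cancellations.\<close>

lemma even_length_if_word_prod_one:
  assumes "ss \<in> lists S" "word_prod W ss = \<one>"
  shows "even (length ss)"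
proof -
  obtain m where pres: "has_presentation W S (coxeter_relators S m)"
    using coxeter by (auto simp: coxeter_system_def)
  have "map (\<lambda>s. (s, True)) ss \<in> lists (S \<times> UNIV)" using assms(1) by auto
  then have "presented_eq S (coxeter_relators S m) (map (\<lambda>s. (s, True)) ss) []"
    using pres assms(2) by (auto simp: has_presentation_def word_prod_conv_gword_value)
  from presented_eq_parity[OF this] even_length_coxeter_relator show ?thesis by fastforce
qed

text \<open>Since reversal inverts the product, \<open>ss @ rev ts\<close> is a word for the
  identity.\<close>

lemma word_prod_eq_parity:
  assumes "ss \<in> lists S" "ts \<in> lists S" "word_prod W ss = word_prod W ts"
  shows "even (length ss) = even (length ts)"
proof -
  have "ss @ rev ts \<in> lists S" using assms by auto
  moreover have "word_prod W (ss @ rev ts) = \<one>"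
    using assms by (simp add: word_prod_append word_prod_rev in_lists_conv_set)
  ultimately show ?thesis using even_length_if_word_prod_one by fastforce
qed

lemma len_le: "ss \<in> lists S \<Longrightarrow> len (word_prod W ss) \<le> length ss"
  unfolding cox_length_def by (rule Least_le) auto

lemma obtain_reduced_word:
  assumes "w \<in> carrier W"
  obtains ss where "ss \<in> reduced_words W S" "word_prod W ss = w"
proof -
  have "\<exists>n. \<exists>ss\<in>lists S. length ss = n \<and> word_prod W ss = w"
    using word_prod_surj[OF assms] by auto
  from LeastI_ex[OF this] obtain ss where
    "ss \<in> lists S" "length ss = len w" "word_prod W ss = w"
    unfolding cox_length_def by auto
  then show ?thesis using that[of ss] by (simp add: reduced_words_def)
qed

lemma len_mult_le: assumes "s \<in> S" "w \<in> carrier W" shows "len (s \<otimes> w) \<le> len w + 1"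
proof -
  obtain ss where "ss \<in> reduced_words W S" "word_prod W ss = w"
    using obtain_reduced_word[OF assms(2)] .
  then show ?thesis using len_le[of "s # ss"] assms by (auto simp: reduced_words_def)
qed

text \<open>A reduced word of \<open>w\<close> with \<open>s\<close> put in front and a reduced word
  of \<open>s \<otimes> w\<close> have the same product, hence lengths of equal parity.\<close>

lemma len_mult_parity:
  assumes "s \<in> S" "w \<in> carrier W" shows "even (len (s \<otimes> w)) \<noteq> even (len w)"
proof -
  obtain ss where ss: "ss \<in> reduced_words W S" "word_prod W ss = w"
    using obtain_reduced_word[OF assms(2)] .
  obtain ts where ts: "ts \<in> reduced_words W S" "word_prod W ts = s \<otimes> w"
    using obtain_reduced_word[of "s \<otimes> w"] assms by auto
  have "even (length ts) = even (length (s # ss))"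
    using assms ss ts by (intro word_prod_eq_parity) (auto simp: reduced_words_def)
  then show ?thesis using ss ts by (auto simp: reduced_words_def)
qed

text \<open>Multiplication by a generator changes the length by at most one, and parity forbids
  equality; so failing to be a descent means a rise by exactly one.\<close>

lemma len_mult_not_descent:
  assumes "s \<in> S" "w \<in> carrier W"
  shows "s \<notin> left_descents W S w \<longleftrightarrow> len (s \<otimes> w) = len w + 1"
proof -
  \<comment> \<open>The upper bound for \<open>s \<otimes> w\<close> in place of \<open>w\<close>,
    because \<open>s\<close> is an involution.\<close>
  have "len w \<le> len (s \<otimes> w) + 1"
    using len_mult_le[of s "s \<otimes> w"] generator_mult_cancel assms by auto
  moreover have "len (s \<otimes> w) \<noteq> len w" using len_mult_parity assms by metis
  ultimately show ?thesis using len_mult_le[OF assms] assms by (auto simp: left_descents_def)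
qed

lemma len_inv_le: assumes "w \<in> carrier W" shows "len (inv w) \<le> len w"
proof -
  obtain ss where "ss \<in> reduced_words W S" "word_prod W ss = w"
    using obtain_reduced_word[OF assms] .
  then show ?thesis using len_le[of "rev ss"]
    by (auto simp: word_prod_rev reduced_words_def in_lists_conv_set)
qed

lemma len_inv: "w \<in> carrier W \<Longrightarrow> len (inv w) = len w"
  using len_inv_le[of w] len_inv_le[of "inv w"] by simp

lemma reduced_words_Nil: "[] \<in> reduced_words W S"
  using len_le[of "[]"] by (simp add: reduced_words_def)

text \<open>An automaton reads letters at the right end of a word, while descents and regular
  partitions concern multiplication on the left. Inversion passes between the two.\<close>

lemma inv_word_prod_snoc:
  "ss \<in> lists S \<Longrightarrow> s \<in> S \<Longrightarrow>
    inv (word_prod W (ss @ [s])) = s \<otimes> inv (word_prod W ss)"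
  by (simp add: word_prod_append inv_mult_group inv_generator)

lemma reduced_words_snoc:
  "ss @ [s] \<in> reduced_words W S \<longleftrightarrow>
    ss \<in> reduced_words W S \<and> s \<in> S \<and> s \<notin> left_descents W S (inv (word_prod W ss))"
proof (cases "ss \<in> lists S \<and> s \<in> S")
  case True
  then have ss: "ss \<in> lists S" and s: "s \<in> S" and w: "word_prod W ss \<in> carrier W" by auto
  have "len (s \<otimes> inv (word_prod W ss)) = len (word_prod W (ss @ [s]))"
    using ss s len_inv[of "word_prod W (ss @ [s])"] by (simp only: inv_word_prod_snoc) simp
  then have "s \<notin> left_descents W S (inv (word_prod W ss)) \<longleftrightarrow>
      len (word_prod W (ss @ [s])) = len (word_prod W ss) + 1"
    using len_mult_not_descent[OF s, of "inv (word_prod W ss)"] w by (simp add: len_inv)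
  moreover have "len (word_prod W (ss @ [s])) \<le> len (word_prod W ss) + 1"
    using len_mult_le[OF s, of "inv (word_prod W ss)"] w
      \<open>len (s \<otimes> inv (word_prod W ss)) = len (word_prod W (ss @ [s]))\<close> by (simp add: len_inv)
  \<comment> \<open>The chain \<open>len (word_prod W (ss @ [s])) \<le> len (word_prod W ss) + 1
    \<le> length ss + 1\<close> has equal ends exactly when both inequalities are equalities: the
    letter raises the length, and \<open>ss\<close> is reduced.\<close>
  ultimately show ?thesis
    using ss s len_le[OF ss] by (auto simp: reduced_words_def)
qed (auto simp: reduced_words_def)

lemma descents_one: "left_descents W S \<one> = {}"
  using reduced_words_Nil by (auto simp: left_descents_def reduced_words_def)

text \<open>The last letter of a nonempty reduced word of \<open>inv w\<close> is a left descent of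
  \<open>w\<close>. This will force the part containing the identity to be a singleton.\<close>

lemma no_descents_imp_one:
  assumes "w \<in> carrier W" "left_descents W S w = {}" shows "w = \<one>"
proof -
  obtain ss where ss: "ss \<in> reduced_words W S" "word_prod W ss = inv w"
    using obtain_reduced_word[OF inv_closed[OF assms(1)]] .
  show ?thesis
  proof (cases ss rule: rev_cases)
    case Nil
    then show ?thesis using ss assms(1) by (metis inv_inv inv_one word_prod_Nil)
  next
    case (snoc ts s)
    have ts: "ts \<in> reduced_words W S" "s \<in> S"
      and nd: "s \<notin> left_descents W S (inv (word_prod W ts))"
      using ss(1) snoc reduced_words_snoc by auto
    have tsl: "ts \<in> lists S" using ts by (auto simp: reduced_words_def)
    have w: "w = s \<otimes> inv (word_prod W ts)"
      using ss(2) snoc assms(1) inv_word_prod_snoc[OF tsl ts(2)] by simp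
    then have "s \<otimes> w = inv (word_prod W ts)"
      using generator_mult_cancel[of s "inv (word_prod W ts)"] ts tsl by simp
    then have "s \<in> left_descents W S w"
      using nd w ts tsl len_mult_not_descent[of s "inv (word_prod W ts)"]
      by (simp add: left_descents_def)
    then show ?thesis using assms by simp
  qed
qed

end

section \<open>The automaton of a regular partition\<close>

locale coxeter_regular_partition = coxeter_group +
  fixes P
  assumes regular: "regular_partition W S P"
begin

lemma partition: "partition_on (carrier W) P"
  using regular by (simp add: regular_partition_def)

lemma part_unique: "R \<in> P \<Longrightarrow> R' \<in> P \<Longrightarrow> x \<in> R \<Longrightarrow> x \<in> R' \<Longrightarrow> R = R'"
  using partition_onD2[OF partition] by (auto simp: disjoint_def)

lemma part_closed: "R \<in> P \<Longrightarrow> x \<in> R \<Longrightarrow> x \<in> carrier W"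
  using partition_onD1[OF partition] by auto

lemma part_nonempty: "R \<in> P \<Longrightarrow> R \<noteq> {}"
  using partition_onD3[OF partition] by auto

text \<open>Descents are constant on a part, so any element of it determines the definite
  description in \<open>part_descents\<close>.\<close>

lemma part_descents_eq:
  assumes "R \<in> P" "x \<in> R" shows "part_descents W S R = left_descents W S x"
  unfolding part_descents_def
proof (rule the_equality)
  show "\<forall>y\<in>R. left_descents W S y = left_descents W S x"
    using regular assms unfolding regular_partition_def by blast
qed (use assms in auto)

text \<open>Every element of the part of the identity shares its empty descent set. Thus the start
  state is a state.\<close>

lemma singleton_one_part: "{\<one>} \<in> P"
proof -
  obtain R where R: "R \<in> P" "\<one> \<in> R" using partition_onD1[OF partition] by blast
  have "x = \<one>" if "x \<in> R" for x
    using part_descents_eq[OF R(1) that] part_descents_eq[OF R] descents_one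
      no_descents_imp_one[OF part_closed[OF R(1) that]] by simp
  then have "R = {\<one>}" using R by blast
  then show ?thesis using R by simp
qed

lemma translate_part_ex:
  "R \<in> P \<Longrightarrow> s \<in> S \<Longrightarrow> s \<notin> part_descents W S R \<Longrightarrow> \<exists>R'\<in>P. s <# R \<subseteq> R'"
  using regular unfolding regular_partition_def by blast

text \<open>A translate of a part is nonempty, so disjointness lets it lie in at most one
  part.\<close>

lemma translate_part_the:
  assumes "R \<in> P" "R' \<in> P" "s <# R \<subseteq> R'"
  shows "(THE R'. R' \<in> P \<and> s <# R \<subseteq> R') = R'"
proof (rule the_equality)
  fix Q assume Q: "Q \<in> P \<and> s <# R \<subseteq> Q"
  obtain x where "x \<in> R" using part_nonempty assms by blast
  then have "s \<otimes> x \<in> s <# R" by (auto simp: l_coset_def)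
  then show "Q = R'" using Q assms part_unique by blast
qed (use assms in auto)

lemma trans_descent:
  "s \<in> part_descents W S R \<Longrightarrow> au_trans (partition_automaton W S P) R s = None"
  by (simp add: partition_automaton_def)

lemma trans_not_descent:
  "R \<in> P \<Longrightarrow> R' \<in> P \<Longrightarrow> s \<notin> part_descents W S R \<Longrightarrow> s <# R \<subseteq> R' \<Longrightarrow>
    au_trans (partition_automaton W S P) R s = Some R'"
  by (simp add: partition_automaton_def translate_part_the)

text \<open>The induction adds letters at the right end, where the run advances. Both outcomes are
  carried along, since the step needs to know the state after an arbitrary prefix.\<close>

lemma run_partition_automaton:
  assumes "ss \<in> lists S"
  shows "if ss \<in> reduced_words W S
    then \<exists>R\<in>P. inv (word_prod W ss) \<in> R \<and> au_run (partition_automaton W S P) ss = Some R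
    else au_run (partition_automaton W S P) ss = None"
  using assms
proof (induction ss rule: rev_induct)
  case Nil
  then show ?case
    using reduced_words_Nil singleton_one_part by (auto simp: au_run_def partition_automaton_def)
next
  case (snoc s ss)
  then have ss: "ss \<in> lists S" and s: "s \<in> S" by auto
  show ?case
  proof (cases "ss \<in> reduced_words W S")
    case False
    \<comment> \<open>The dead state is absorbing, and no extension of a word that is not reduced is
      reduced.\<close>
    then show ?thesis using snoc ss by (auto simp: reduced_words_snoc au_run_snoc)
  next
    case True
    then obtain R where R: "R \<in> P" "inv (word_prod W ss) \<in> R"
      and run: "au_run (partition_automaton W S P) ss = Some R"
      using snoc ss by auto
    show ?thesis
    proof (cases "s \<in> part_descents W S R")
      case in_desc: True
      then show ?thesis
        using part_descents_eq[OF R] run by (simp add: reduced_words_snoc au_run_snoc trans_descent)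
    next
      case not_desc: False
      then obtain R' where R': "R' \<in> P" "s <# R \<subseteq> R'" using translate_part_ex R s by blast
      \<comment> \<open>The new inverse is the old one multiplied by \<open>s\<close> on the left,
        so it lies in \<open>s <# R\<close>.\<close>
      then have "inv (word_prod W (ss @ [s])) \<in> R'"
        using R(2) unfolding inv_word_prod_snoc[OF ss s] l_coset_def by auto
      then show ?thesis
        using not_desc R' True s part_descents_eq[OF R] run trans_not_descent[OF R(1) R'(1) not_desc R'(2)]
        by (auto simp: reduced_words_snoc au_run_snoc)
    qed
  qed
qed

lemma is_automaton_partition_automaton: "is_automaton S (partition_automaton W S P)"
  unfolding is_automaton_def
proof (intro conjI ballI)
  show "au_start (partition_automaton W S P) \<in> au_states (partition_automaton W S P)"
    using singleton_one_part by (simp add: partition_automaton_def)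
next
  fix R s assume "R \<in> au_states (partition_automaton W S P)" and s: "s \<in> S"
  then have R: "R \<in> P" by (simp add: partition_automaton_def)
  show "au_trans (partition_automaton W S P) R s
      \<in> insert None (Some ` au_states (partition_automaton W S P))"
  proof (cases "s \<in> part_descents W S R")
    case False
    then obtain R' where R': "R' \<in> P" "s <# R \<subseteq> R'" using translate_part_ex R s by blast
    then show ?thesis using trans_not_descent[OF R R'(1) False R'(2)]
      by (simp add: partition_automaton_def)
  qed (simp add: trans_descent)
qed

text \<open>Two reduced words of one element lead to parts that both contain its inverse, hence to
  the same part.\<close>

lemma reduced_partition_automaton: "reduced_automaton W S (partition_automaton W S P)"
proof -
  let ?A = "partition_automaton W S P"
  have "au_accepted S ?A = reduced_words W S"
  proof (rule Set.set_eqI)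
    fix ss
    show "ss \<in> au_accepted S ?A \<longleftrightarrow> ss \<in> reduced_words W S"
    proof (cases "ss \<in> lists S")
      case True
      then show ?thesis using run_partition_automaton[OF True]
        by (auto simp: au_accepted_def partition_automaton_def split: if_splits)
    qed (auto simp: au_accepted_def reduced_words_def)
  qed
  moreover have "au_run ?A ss = au_run ?A ts"
    if red: "ss \<in> reduced_words W S" "ts \<in> reduced_words W S"
      and eq: "word_prod W ss = word_prod W ts" for ss ts
  proof -
    have "ss \<in> lists S" "ts \<in> lists S" using red by (auto simp: reduced_words_def)
    then obtain R R' where "R \<in> P" "inv (word_prod W ss) \<in> R" "au_run ?A ss = Some R"
      "R' \<in> P" "inv (word_prod W ts) \<in> R'" "au_run ?A ts = Some R'"
      using run_partition_automaton red by metis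
    then show ?thesis using part_unique eq by metis
  qed
  ultimately show ?thesis
    using is_automaton_partition_automaton
    unfolding reduced_automaton_def recognises_reduced_words_def by blast
qed

end

section \<open>The regular partition of a reduced automaton\<close>

locale coxeter_reduced_automaton = coxeter_group W S
  for W :: "('a, 'b) monoid_scheme" (structure) and S +
  fixes A :: "('q, 'a) automaton"
  assumes reduced: "reduced_automaton W S A"
    and accessible: "au_accessible S A"
begin

definition fibre :: "'q \<Rightarrow> 'a set" where
  "fibre y = {inv (word_prod W ss) | ss. ss \<in> reduced_words W S \<and> au_run A ss = Some y}"

lemma accepted: "ss \<in> lists S \<Longrightarrow> au_run A ss \<in> Some ` au_states A \<longleftrightarrow> ss \<in> reduced_words W S"
  using reduced by (auto simp: reduced_automaton_def recognises_reduced_words_def au_accepted_def)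

lemma trans_states:
  "y \<in> au_states A \<Longrightarrow> s \<in> S \<Longrightarrow> au_trans A y s \<in> insert None (Some ` au_states A)"
  using reduced
  by (simp add: reduced_automaton_def recognises_reduced_words_def is_automaton_def)

lemma run_eq:
  assumes "ss \<in> reduced_words W S" "ts \<in> reduced_words W S"
    and "inv (word_prod W ss) = inv (word_prod W ts)"
  shows "au_run A ss = au_run A ts"
proof -
  have "word_prod W ss = word_prod W ts"
    using assms inv_inj by (auto simp: reduced_words_def inj_on_def)
  then show ?thesis using reduced assms(1,2) unfolding reduced_automaton_def by blast
qed

text \<open>The automaton is reduced, so all reduced words of \<open>inv x\<close> end in one state.
  Distinct fibres are therefore disjoint.\<close>

lemma fibre_unique: "x \<in> fibre y \<Longrightarrow> x \<in> fibre z \<Longrightarrow> y = z"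
  unfolding fibre_def using run_eq by (smt (verit) mem_Collect_eq option.inject)

lemma fibre_closed: "fibre y \<subseteq> carrier W"
  by (auto simp: fibre_def reduced_words_def in_lists_conv_set)

text \<open>Accessibility provides a word ending in \<open>y\<close>; as \<open>y\<close> is an
  accept state, this word is accepted and hence reduced.\<close>

lemma fibre_nonempty: assumes "y \<in> au_states A" shows "fibre y \<noteq> {}"
proof -
  obtain ss where "ss \<in> lists S" "au_run A ss = Some y"
    using accessible assms by (auto simp: au_accessible_def)
  then show ?thesis using accepted[of ss] assms by (auto simp: fibre_def)
qed

lemma fibre_ex: assumes "x \<in> carrier W" shows "\<exists>y\<in>au_states A. x \<in> fibre y"
proof -
  obtain ss where ss: "ss \<in> reduced_words W S" "word_prod W ss = inv x"
    using obtain_reduced_word[OF inv_closed[OF assms]] .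
  then obtain y where "y \<in> au_states A" "au_run A ss = Some y"
    using accepted[of ss] by (auto simp: reduced_words_def)
  then show ?thesis using ss assms unfolding fibre_def by force
qed

text \<open>Take a reduced word ending in \<open>y\<close> whose product has inverse
  \<open>x\<close>. Appending \<open>s\<close> gives an accepted word iff the result is reduced,
  that is, iff \<open>s\<close> is not a descent of \<open>x\<close>.\<close>

lemma trans_eq_None_iff:
  assumes "y \<in> au_states A" "x \<in> fibre y" "s \<in> S"
  shows "au_trans A y s = None \<longleftrightarrow> s \<in> left_descents W S x"
proof -
  obtain ss where ss: "ss \<in> reduced_words W S" "au_run A ss = Some y" "x = inv (word_prod W ss)"
    using assms(2) by (auto simp: fibre_def)
  then have "ss @ [s] \<in> lists S" using assms by (auto simp: reduced_words_def)
  then have "au_trans A y s \<in> Some ` au_states A \<longleftrightarrow> s \<notin> left_descents W S x"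
    using accepted[of "ss @ [s]"] ss assms(3) by (simp add: reduced_words_snoc au_run_snoc)
  \<comment> \<open>A transition from a state leads to a state or to the dead state, so missing the
    states means \<open>None\<close>.\<close>
  then show ?thesis using trans_states[OF assms(1,3)] by auto
qed

text \<open>The right-hand side depends on \<open>y\<close> alone, which gives the constancy of
  descents on a fibre.\<close>

lemma fibre_descents:
  assumes "y \<in> au_states A" "x \<in> fibre y"
  shows "left_descents W S x = {s \<in> S. au_trans A y s = None}"
  using trans_eq_None_iff[OF assms] by (auto simp: left_descents_def)

lemma part_descents_fibre:
  assumes "y \<in> au_states A"
  shows "part_descents W S (fibre y) = {s \<in> S. au_trans A y s = None}"
  unfolding part_descents_def using fibre_descents[OF assms] fibre_nonempty[OF assms]
  by (intro the_equality) auto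

text \<open>The transition is alive, so \<open>s\<close> is not a descent of any element of the
  fibre; appending \<open>s\<close> to a reduced word ending in \<open>y\<close> thus gives a
  reduced word ending in \<open>z\<close>.\<close>

lemma translate_fibre:
  assumes "y \<in> au_states A" "s \<in> S" "au_trans A y s = Some z"
  shows "s <# fibre y \<subseteq> fibre z"
proof
  fix x assume "x \<in> s <# fibre y"
  then obtain ss where ss: "ss \<in> reduced_words W S" "au_run A ss = Some y"
    and x: "x = s \<otimes> inv (word_prod W ss)"
    by (auto simp: l_coset_def fibre_def)
  have ssl: "ss \<in> lists S" using ss by (auto simp: reduced_words_def)
  have "inv (word_prod W ss) \<in> fibre y" using ss by (auto simp: fibre_def)
  then have "ss @ [s] \<in> reduced_words W S"
    using trans_eq_None_iff[OF assms(1) _ assms(2)] ss assms by (auto simp: reduced_words_snoc)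
  moreover have "au_run A (ss @ [s]) = Some z" using ss assms by (simp add: au_run_snoc)
  ultimately show "x \<in> fibre z"
    unfolding fibre_def x using inv_word_prod_snoc[OF ssl assms(2)] by force
qed

lemma regular_fibres: "regular_partition W S (fibre ` au_states A)"
  unfolding regular_partition_def
proof (intro conjI ballI)
  show "partition_on (carrier W) (fibre ` au_states A)"
  proof (rule partition_onI)
    show "\<Union> (fibre ` au_states A) = carrier W" using fibre_ex fibre_closed by blast
    show "{} \<notin> fibre ` au_states A" using fibre_nonempty by auto
    show "disjnt p p'" if "p \<in> fibre ` au_states A" "p' \<in> fibre ` au_states A" "p \<noteq> p'" for p p'
      using that fibre_unique unfolding disjnt_iff by blast
  qed
next
  fix R x y assume "R \<in> fibre ` au_states A" "x \<in> R" "y \<in> R"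
  then show "left_descents W S x = left_descents W S y" using fibre_descents by blast
next
  fix R s assume "R \<in> fibre ` au_states A" and s: "s \<in> S - part_descents W S R"
  then obtain y where y: "y \<in> au_states A" "R = fibre y" by auto
  then obtain z where "z \<in> au_states A" "au_trans A y s = Some z"
    using s trans_states[of y s] part_descents_fibre by auto
  then show "\<exists>R'\<in>fibre ` au_states A. s <# R \<subseteq> R'"
    using translate_fibre y s by blast
qed

text \<open>The isomorphism is \<open>fibre\<close> itself, injective because fibres of distinct
  states are disjoint and nonempty.\<close>

lemma isomorphic_fibre_automaton:
  "automata_isomorphic S A (partition_automaton W S (fibre ` au_states A))"
proof -
  interpret P: coxeter_regular_partition W S "fibre ` au_states A"
    by unfold_locales (rule regular_fibres)
  let ?B = "partition_automaton W S (fibre ` au_states A)"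
  have states: "au_states ?B = fibre ` au_states A" by (simp add: partition_automaton_def)
  have inj: "inj_on fibre (au_states A)"
    using fibre_unique fibre_nonempty unfolding inj_on_def by (metis ex_in_conv)
  have start: "fibre (au_start A) = au_start ?B"
  proof -
    have "au_start A \<in> au_states A"
      using reduced
      by (simp add: reduced_automaton_def recognises_reduced_words_def is_automaton_def)
    \<comment> \<open>The empty word is reduced and its run stays at the start state; the part
      containing the identity can only be the singleton.\<close>
    moreover have "\<one> \<in> fibre (au_start A)"
      unfolding fibre_def using reduced_words_Nil by (force simp: au_run_def)
    ultimately have "fibre (au_start A) = {\<one>}"
      using P.part_unique P.singleton_one_part by blast
    then show ?thesis by (simp add: partition_automaton_def)
  qed
  have trans: "au_trans ?B (fibre x) s = Some (fibre y)"
    if "x \<in> au_states A" "y \<in> au_states A" "s \<in> S" "au_trans A x s = Some y" for x y s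
    using that P.trans_not_descent[of "fibre x" "fibre y" s] part_descents_fibre translate_fibre
    by auto
  \<comment> \<open>A live transition between fibres excludes a descent, so \<open>A\<close> moves
    from \<open>x\<close> to some \<open>z\<close>; the forward direction and injectivity of
    \<open>fibre\<close> identify \<open>z\<close> with \<open>y\<close>.\<close>
  have trans_back: "au_trans A x s = Some y"
    if xy: "x \<in> au_states A" "y \<in> au_states A" "s \<in> S"
      and B: "au_trans ?B (fibre x) s = Some (fibre y)" for x y s
  proof -
    have "s \<notin> part_descents W S (fibre x)" using P.trans_descent B by auto
    then obtain z where z: "z \<in> au_states A" "au_trans A x s = Some z"
      using xy part_descents_fibre[OF xy(1)] trans_states[OF xy(1,3)] by auto
    then have "fibre z = fibre y" using trans[OF xy(1) z(1) xy(3) z(2)] B by simp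
    then show ?thesis using inj z xy by (auto dest: inj_onD)
  qed
  show ?thesis
    unfolding automata_isomorphic_def states
  proof (intro exI[of _ fibre] conjI ballI impI)
    fix x y s assume "x \<in> au_states A" "y \<in> au_states A" "s \<in> S" "au_trans A x s = Some y"
    then show "au_trans ?B (fibre x) s = Some (fibre y)" by (rule trans)
  next
    fix x' y' s assume *: "x' \<in> fibre ` au_states A" "y' \<in> fibre ` au_states A" "s \<in> S"
      "au_trans ?B x' s = Some y'"
    then obtain x y where "x \<in> au_states A" "y \<in> au_states A" "x' = fibre x" "y' = fibre y"
      by blast
    then show "\<exists>x\<in>au_states A. \<exists>y\<in>au_states A.
        fibre x = x' \<and> fibre y = y' \<and> au_trans A x s = Some y"
      using trans_back * by blast
  qed (use inj start in simp_all)
qed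

end

theorem theorem2:
  fixes W :: "('a, 'b) monoid_scheme" and S :: "'a set"
  assumes "coxeter_system W S" and "finite S"
  shows "(\<forall>P. regular_partition W S P \<longrightarrow>
            reduced_automaton W S (partition_automaton W S P) \<and>
            au_states (partition_automaton W S P) = P \<and>
            au_start (partition_automaton W S P) = {\<one>\<^bsub>W\<^esub>} \<and>
            (\<forall>R\<in>P. \<forall>s\<in>S.
               (s \<in> part_descents W S R \<longrightarrow>
                  au_trans (partition_automaton W S P) R s = None) \<and>
               (\<forall>R'\<in>P. s \<notin> part_descents W S R \<and> s <#\<^bsub>W\<^esub> R \<subseteq> R' \<longrightarrow>
                  au_trans (partition_automaton W S P) R s = Some R')))
       \<and> (\<forall>A :: ('q, 'a) automaton. reduced_automaton W S A \<and> au_accessible S A \<longrightarrow>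
            (\<exists>P. regular_partition W S P \<and>
                 automata_isomorphic S A (partition_automaton W S P)))"
proof -
  from assms(1) have "group W" by (auto simp: coxeter_system_def has_presentation_def)
  then interpret coxeter_group W S
    using assms(1) by (simp add: coxeter_group_def coxeter_group_axioms_def)
  show ?thesis
  proof (rule conjI; intro allI impI)
    fix P assume "regular_partition W S P"
    then interpret coxeter_regular_partition W S P by unfold_locales
    show "reduced_automaton W S (partition_automaton W S P) \<and>
      au_states (partition_automaton W S P) = P \<and>
      au_start (partition_automaton W S P) = {\<one>\<^bsub>W\<^esub>} \<and>
      (\<forall>R\<in>P. \<forall>s\<in>S.
         (s \<in> part_descents W S R \<longrightarrow> au_trans (partition_automaton W S P) R s = None) \<and>
         (\<forall>R'\<in>P. s \<notin> part_descents W S R \<and> s <#\<^bsub>W\<^esub> R \<subseteq> R' \<longrightarrow>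
            au_trans (partition_automaton W S P) R s = Some R'))"
      using reduced_partition_automaton trans_descent trans_not_descent
      by (auto simp: partition_automaton_def)
  next
    fix A :: "('q, 'a) automaton"
    assume "reduced_automaton W S A \<and> au_accessible S A"
    then interpret coxeter_reduced_automaton W S A by unfold_locales auto
    \<comment> \<open>The witness is the family of fibres of the accept states.\<close>
    show "\<exists>P. regular_partition W S P \<and> automata_isomorphic S A (partition_automaton W S P)"
      using regular_fibres isomorphic_fibre_automaton by blast
  qed
qed

end
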